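(* Let $\mathcal C_1,\mathcal C_2,\mathcal D_1,\mathcal D_2$ be categories. Then $B:\mathcal C_1\times\mathcal C_2\to\mathcal D_1\times\mathcal D_2$ is a bifunctor if and only if $B$ can be expressed as a product of common domain for two bifunctors $p:\mathcal C_1\times\mathcal C_2\to\mathcal D_1$ and $q:\mathcal C_1\times\mathcal C_2\to\mathcal D_2$.
   Context: Here $B$ is a two part function, sending objects of $\mathcal C_1\times\mathcal C_2$ to objects and arrows to arrows of the target category. "Bifunctor" means contravariant in the first argument and covariant in the second: a two part function $B:\mathcal C_1\times\mathcal C_2\to\mathcal D$ is a bifunctor if 1) $B(1_a,1_b)=1_{B(a,b)}$ for all objects $(a,b)$; 2) each arrow $(f,g):(a,b)\to(c,d)$ (with $f:a\to c$ in $\mathcal C_1$, $g:b\to d$ in $\mathcal C_2$) is sent to an arrow $B(f,g):B(c,b)\to B(a,d)$; 3) $B(h\circ f,\,i\circ g)=B(f,i)\circ B(h,g)$ for all $f:a\to c$, $h:c\to x$ in $\mathcal C_1$ and $g:b\to d$, $i:d\to y$ in $\mathcal C_2$. The product of common domain of $p$ and $q$ is the two part function $p\times q:\mathcal C_1\times\mathcal C_2\to\mathcal D_1\times\mathcal D_2$ with $(p\times q)(a,b)=(p(a,b),q(a,b))$ on objects and $(p\times q)(f,g)=(p(f,g),q(f,g))$ on arrows. *)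

theory Defs
  imports "HOL-Library.FuncSet"
begin

record ('o, 'a) category_data =
  Ob :: "'o set"
  Arr :: "'a set"
  Dom :: "'a \<Rightarrow> 'o"
  Cod :: "'a \<Rightarrow> 'o"
  Ident :: "'o \<Rightarrow> 'a"
  Comp :: "'a \<Rightarrow> 'a \<Rightarrow> 'a"

text \<open>Composition is written in applicative order: \<open>Comp C g f\<close> is \<open>g \<circ> f\<close>,
  and its value is meaningful only if \<open>Dom C g = Cod C f\<close>.\<close>

definition arrow :: "('o, 'a) category_data \<Rightarrow> 'a \<Rightarrow> 'o \<Rightarrow> 'o \<Rightarrow> bool" where
  "arrow C f a b \<longleftrightarrow> f \<in> Arr C \<and> Dom C f = a \<and> Cod C f = b"

locale category =
  fixes C :: "('o, 'a) category_data"
  assumes Dom_in_Ob: "f \<in> Arr C \<Longrightarrow> Dom C f \<in> Ob C"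
    and Cod_in_Ob: "f \<in> Arr C \<Longrightarrow> Cod C f \<in> Ob C"
    and Ident_arrow: "a \<in> Ob C \<Longrightarrow> arrow C (Ident C a) a a"
    and Comp_arrow: "\<lbrakk>arrow C f a b; arrow C g b c\<rbrakk> \<Longrightarrow> arrow C (Comp C g f) a c"
    and Comp_Ident_right: "arrow C f a b \<Longrightarrow> Comp C f (Ident C a) = f"
    and Comp_Ident_left: "arrow C f a b \<Longrightarrow> Comp C (Ident C b) f = f"
    and Comp_assoc: "\<lbrakk>arrow C f a b; arrow C g b c; arrow C h c d\<rbrakk>
      \<Longrightarrow> Comp C h (Comp C g f) = Comp C (Comp C h g) f"

definition prod_cat :: "('o1, 'a1) category_data \<Rightarrow> ('o2, 'a2) category_data
    \<Rightarrow> ('o1 \<times> 'o2, 'a1 \<times> 'a2) category_data" (infixr "\<times>\<^sub>C" 80) where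
  "C1 \<times>\<^sub>C C2 =
    \<lparr> Ob = Ob C1 \<times> Ob C2,
      Arr = Arr C1 \<times> Arr C2,
      Dom = (\<lambda>(f, g). (Dom C1 f, Dom C2 g)),
      Cod = (\<lambda>(f, g). (Cod C1 f, Cod C2 g)),
      Ident = (\<lambda>(a, b). (Ident C1 a, Ident C2 b)),
      Comp = (\<lambda>(h, i) (f, g). (Comp C1 h f, Comp C2 i g)) \<rparr>"

lemma arrow_prod_cat:
  "arrow (C1 \<times>\<^sub>C C2) (f, g) (a, b) (c, d) \<longleftrightarrow> arrow C1 f a c \<and> arrow C2 g b d"
  by (auto simp: arrow_def prod_cat_def)

lemma category_prod_cat:
  assumes "category C1" and "category C2"
  shows "category (C1 \<times>\<^sub>C C2)"
proof -
  interpret C1: category C1 by fact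
  interpret C2: category C2 by fact
  show ?thesis
    using C1.Dom_in_Ob C2.Dom_in_Ob C1.Cod_in_Ob C2.Cod_in_Ob C1.Ident_arrow C2.Ident_arrow
      C1.Comp_arrow C2.Comp_arrow C1.Comp_Ident_right C2.Comp_Ident_right
      C1.Comp_Ident_left C2.Comp_Ident_left C1.Comp_assoc C2.Comp_assoc
    by unfold_locales (auto simp: prod_cat_def arrow_def)
qed

record ('o, 'a, 'p, 'b) two_part =
  on_ob :: "'o \<Rightarrow> 'p"
  on_arr :: "'a \<Rightarrow> 'b"

definition two_part_function ::
  "('o, 'a) category_data \<Rightarrow> ('p, 'b) category_data \<Rightarrow> ('o, 'a, 'p, 'b) two_part \<Rightarrow> bool" where
  "two_part_function C D F \<longleftrightarrow> on_ob F \<in> Ob C \<rightarrow> Ob D \<and> on_arr F \<in> Arr C \<rightarrow> Arr D"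

text \<open>Equality of two part functions with domain \<open>C\<close>: the values of the underlying HOL
  functions outside the objects and arrows of \<open>C\<close> are irrelevant.\<close>

definition two_part_eq ::
  "('o, 'a) category_data \<Rightarrow> ('o, 'a, 'p, 'b) two_part \<Rightarrow> ('o, 'a, 'p, 'b) two_part \<Rightarrow> bool" where
  "two_part_eq C F G \<longleftrightarrow>
    (\<forall>a \<in> Ob C. on_ob F a = on_ob G a) \<and> (\<forall>f \<in> Arr C. on_arr F f = on_arr G f)"

text \<open>Contravariant in the first argument, covariant in the second.\<close>

definition bifunctor ::
  "('o1, 'a1) category_data \<Rightarrow> ('o2, 'a2) category_data \<Rightarrow> ('p, 'b) category_data
    \<Rightarrow> ('o1 \<times> 'o2, 'a1 \<times> 'a2, 'p, 'b) two_part \<Rightarrow> bool" where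
  "bifunctor C1 C2 D B \<longleftrightarrow>
    two_part_function (C1 \<times>\<^sub>C C2) D B \<and>
    (\<forall>a \<in> Ob C1. \<forall>b \<in> Ob C2.
      on_arr B (Ident C1 a, Ident C2 b) = Ident D (on_ob B (a, b))) \<and>
    (\<forall>f g a b c d. arrow C1 f a c \<and> arrow C2 g b d \<longrightarrow>
      arrow D (on_arr B (f, g)) (on_ob B (c, b)) (on_ob B (a, d))) \<and>
    (\<forall>f h g i a c x b d y.
      arrow C1 f a c \<and> arrow C1 h c x \<and> arrow C2 g b d \<and> arrow C2 i d y \<longrightarrow>
      on_arr B (Comp C1 h f, Comp C2 i g) = Comp D (on_arr B (f, i)) (on_arr B (h, g)))"

definition common_domain_prod ::
  "('o, 'a, 'p1, 'b1) two_part \<Rightarrow> ('o, 'a, 'p2, 'b2) two_part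
    \<Rightarrow> ('o, 'a, 'p1 \<times> 'p2, 'b1 \<times> 'b2) two_part" (infixr "\<times>\<^sub>c\<^sub>d" 80) where
  "p \<times>\<^sub>c\<^sub>d q =
    \<lparr> on_ob = (\<lambda>x. (on_ob p x, on_ob q x)),
      on_arr = (\<lambda>u. (on_arr p u, on_arr q u)) \<rparr>"

end

theory Submission
  imports Defs
begin

text \<open>An arrow of a product category is a pair of arrows, and identities, composites, domains and
  codomains are formed componentwise. Every clause in the definition of a bifunctor therefore holds
  in \<^term>\<open>D1 \<times>\<^sub>C D2\<close> exactly when it holds for both components, so that a pairing
  \<^term>\<open>p \<times>\<^sub>c\<^sub>d q\<close> is a bifunctor if and only if \<^term>\<open>p\<close> and \<^term>\<open>q\<close> are
  (\<open>bifunctor_common_domain_prod_iff\<close>). Since every two part function \<^term>\<open>B\<close> into a product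
  category is the pairing of its two coordinates, this gives the decomposition of a bifunctor.

  Conversely, \<^term>\<open>B\<close> is only required to agree with \<^term>\<open>p \<times>\<^sub>c\<^sub>d q\<close> on the objects and
  arrows of the source. That suffices because the definition of a bifunctor evaluates its argument
  at nothing else (\<open>bifunctor_cong\<close>); here the axioms for the source categories enter, as they say
  that identities and composites are arrows and that domains and codomains are objects.\<close>

lemma two_part_function_common_domain_prod_iff:
  "two_part_function C (D1 \<times>\<^sub>C D2) (p \<times>\<^sub>c\<^sub>d q) \<longleftrightarrow>
    two_part_function C D1 p \<and> two_part_function C D2 q"
  by (auto simp: two_part_function_def common_domain_prod_def prod_cat_def Pi_iff)

text \<open>The universal property of \<^term>\<open>D1 \<times>\<^sub>C D2\<close> for bifunctors: each axiom is an equation or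
  a typing statement about pairs, and splits into its two coordinates.\<close>

lemma bifunctor_common_domain_prod_iff:
  "bifunctor C1 C2 (D1 \<times>\<^sub>C D2) (p \<times>\<^sub>c\<^sub>d q) \<longleftrightarrow>
    bifunctor C1 C2 D1 p \<and> bifunctor C1 C2 D2 q"
proof -
  have "on_ob (p \<times>\<^sub>c\<^sub>d q) x = (on_ob p x, on_ob q x)"
    and "on_arr (p \<times>\<^sub>c\<^sub>d q) u = (on_arr p u, on_arr q u)" for x u
    by (simp_all add: common_domain_prod_def)
  moreover have "Ident (D1 \<times>\<^sub>C D2) (a, b) = (Ident D1 a, Ident D2 b)" for a b
    by (simp add: prod_cat_def)
  moreover have "Comp (D1 \<times>\<^sub>C D2) (h, i) (f, g) = (Comp D1 h f, Comp D2 i g)" for h i f g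
    by (simp add: prod_cat_def)
  ultimately show ?thesis
    unfolding bifunctor_def two_part_function_common_domain_prod_iff
    by (simp only: arrow_prod_cat prod.inject imp_conjR ball_conj_distrib all_conj_distrib conj_ac)
qed

lemma common_domain_prod_coordinates:
  "\<lparr>on_ob = fst \<circ> on_ob B, on_arr = fst \<circ> on_arr B\<rparr> \<times>\<^sub>c\<^sub>d
    \<lparr>on_ob = snd \<circ> on_ob B, on_arr = snd \<circ> on_arr B\<rparr> = B"
  by (simp add: common_domain_prod_def)

text \<open>Being a bifunctor depends only on the values at objects and arrows of the source, so it is
  a property of two part functions up to \<^const>\<open>two_part_eq\<close>.\<close>

lemma bifunctor_cong:
  assumes "category C1" and "category C2"
    and eq: "two_part_eq (C1 \<times>\<^sub>C C2) B B'"
    and B': "bifunctor C1 C2 D B'"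
  shows "bifunctor C1 C2 D B"
proof -
  interpret C1: category C1 by fact
  interpret C2: category C2 by fact
  have ob: "on_ob B (a, b) = on_ob B' (a, b)" if "a \<in> Ob C1" "b \<in> Ob C2" for a b
    using eq that by (simp add: two_part_eq_def prod_cat_def)
  have arr: "on_arr B (f, g) = on_arr B' (f, g)" if "arrow C1 f a c" "arrow C2 g b d" for f g a b c d
    using eq that by (simp add: two_part_eq_def prod_cat_def arrow_def)
  have ends1: "a \<in> Ob C1 \<and> c \<in> Ob C1" if "arrow C1 f a c" for f a c
    using that C1.Dom_in_Ob C1.Cod_in_Ob by (auto simp: arrow_def)
  have ends2: "b \<in> Ob C2 \<and> d \<in> Ob C2" if "arrow C2 g b d" for g b d
    using that C2.Dom_in_Ob C2.Cod_in_Ob by (auto simp: arrow_def)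
  show ?thesis
    unfolding bifunctor_def
  proof (intro conjI ballI allI impI; (elim conjE)?)
    show "two_part_function (C1 \<times>\<^sub>C C2) D B"
      using B' eq by (simp add: bifunctor_def two_part_function_def two_part_eq_def Pi_iff)
  next
    fix a b
    assume ab: "a \<in> Ob C1" "b \<in> Ob C2"
    then show "on_arr B (Ident C1 a, Ident C2 b) = Ident D (on_ob B (a, b))"
      using B' by (simp add: bifunctor_def ob arr[OF C1.Ident_arrow C2.Ident_arrow])
  next
    fix f g a b c d
    assume fg: "arrow C1 f a c" "arrow C2 g b d"
    then have "arrow D (on_arr B' (f, g)) (on_ob B' (c, b)) (on_ob B' (a, d))"
      using B' by (simp add: bifunctor_def)
    then show "arrow D (on_arr B (f, g)) (on_ob B (c, b)) (on_ob B (a, d))"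
      using ends1[OF fg(1)] ends2[OF fg(2)] by (simp add: ob arr[OF fg])
  next
    fix f h g i a c x b d y
    assume f: "arrow C1 f a c" and h: "arrow C1 h c x" and g: "arrow C2 g b d" and i: "arrow C2 i d y"
    then have "on_arr B' (Comp C1 h f, Comp C2 i g) = Comp D (on_arr B' (f, i)) (on_arr B' (h, g))"
      using B' unfolding bifunctor_def by blast
    then show "on_arr B (Comp C1 h f, Comp C2 i g) = Comp D (on_arr B (f, i)) (on_arr B (h, g))"
      by (simp add: arr[OF f i] arr[OF h g] arr[OF C1.Comp_arrow[OF f h] C2.Comp_arrow[OF g i]])
  qed
qed

theorem theorem5p17:
  fixes C1 :: "('o1, 'a1) category_data"
    and C2 :: "('o2, 'a2) category_data"
    and D1 :: "('p1, 'b1) category_data"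
    and D2 :: "('p2, 'b2) category_data"
    and B :: "('o1 \<times> 'o2, 'a1 \<times> 'a2, 'p1 \<times> 'p2, 'b1 \<times> 'b2) two_part"
  assumes "category C1" and "category C2" and "category D1" and "category D2"
    and "two_part_function (C1 \<times>\<^sub>C C2) (D1 \<times>\<^sub>C D2) B"
  shows "bifunctor C1 C2 (D1 \<times>\<^sub>C D2) B \<longleftrightarrow>
    (\<exists>p q. bifunctor C1 C2 D1 p \<and> bifunctor C1 C2 D2 q \<and>
      two_part_eq (C1 \<times>\<^sub>C C2) B (p \<times>\<^sub>c\<^sub>d q))"
proof
  assume bif: "bifunctor C1 C2 (D1 \<times>\<^sub>C D2) B"
  define p where "p = \<lparr>on_ob = fst \<circ> on_ob B, on_arr = fst \<circ> on_arr B\<rparr>"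
  define q where "q = \<lparr>on_ob = snd \<circ> on_ob B, on_arr = snd \<circ> on_arr B\<rparr>"
  have B: "p \<times>\<^sub>c\<^sub>d q = B"
    unfolding p_def q_def by (rule common_domain_prod_coordinates)
  have "bifunctor C1 C2 D1 p \<and> bifunctor C1 C2 D2 q"
    using bif by (simp flip: bifunctor_common_domain_prod_iff add: B)
  moreover have "two_part_eq (C1 \<times>\<^sub>C C2) B (p \<times>\<^sub>c\<^sub>d q)"
    by (simp add: B two_part_eq_def)
  ultimately show "\<exists>p q. bifunctor C1 C2 D1 p \<and> bifunctor C1 C2 D2 q \<and>
      two_part_eq (C1 \<times>\<^sub>C C2) B (p \<times>\<^sub>c\<^sub>d q)"
    by blast
next
  assume "\<exists>p q. bifunctor C1 C2 D1 p \<and> bifunctor C1 C2 D2 q \<and>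
      two_part_eq (C1 \<times>\<^sub>C C2) B (p \<times>\<^sub>c\<^sub>d q)"
  then obtain p q where "bifunctor C1 C2 (D1 \<times>\<^sub>C D2) (p \<times>\<^sub>c\<^sub>d q)"
    and "two_part_eq (C1 \<times>\<^sub>C C2) B (p \<times>\<^sub>c\<^sub>d q)"
    by (auto simp: bifunctor_common_domain_prod_iff)
  then show "bifunctor C1 C2 (D1 \<times>\<^sub>C D2) B"
    using bifunctor_cong[OF assms(1,2)] by blast
qed

end
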